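(* Let $F(t)=\sum_{j=0}^\infty b_jt^j$ be a power series with $b_0\in\{-1,1\}$ and $b_j\in\{-1,0,1\}$ for $j\ge1$. Suppose that $F$ has a root at $\gamma\in[\gamma_{low},\gamma_{high}]$, where $0<\gamma_{low}\le\gamma_{high}$ and $\gamma_{high}=.6491-\epsilon$ for some $\epsilon>0$. Let $\delta>0$ be such that $\delta$-transversality holds on the interval $[0,\gamma_{high}]$. Let $N$ be the smallest integer such that $\gamma^{N+1}\le\epsilon\,\delta\,(1-\gamma)$. Then for $n\ge N$: (a) the polynomial $P_n(t)=\sum_{j=0}^nb_jt^j$ has a unique root $\gamma_n$ in $[0,.6491]$; (b) any $\tilde\gamma\in[\gamma_{low},\gamma_{high}]$ which satisfies $|P_n(\tilde\gamma)|\le(\gamma_{low})^n$ also satisfies $|\tilde\gamma-\gamma|\le\tilde C\,\gamma^n$, where $\tilde C=\frac{1}{\delta(1-\gamma)}$.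
   Context: $\delta$-transversality: for $\delta>0$ and an interval $I\subset[0,1)$, $\delta$-transversality holds on $I$ if for every $g$ of the form $g(x)=1+\sum_{j=1}^\infty c_jx^j$ with $c_j\in\{-1,0,1\}$ and every $x\in I$: $g(x)<\delta$ implies $g'(x)<-\delta$. *)

theory Defs
  imports "HOL-Analysis.Analysis"
begin

(* The series 1 + (SUM j>=1. c j * x ^ j); the value c 0 is irrelevant. *)
definition unit_series :: "(nat \<Rightarrow> real) \<Rightarrow> real \<Rightarrow> real" where
  "unit_series c x = 1 + (\<Sum>j. c (Suc j) * x ^ Suc j)"

(* Meant for d > 0 and an interval I contained in [0,1). There the series converges in a
   full neighbourhood of every point of I, so deriv is the genuine derivative, also at 0. *)
definition transversality :: "real \<Rightarrow> real set \<Rightarrow> bool" where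
  "transversality d I \<longleftrightarrow>
     (\<forall>c :: nat \<Rightarrow> real. (\<forall>j\<ge>1. c j \<in> {-1, 0, 1}) \<longrightarrow>
       (\<forall>x\<in>I. unit_series c x < d \<longrightarrow> deriv (unit_series c) x < - d))"

end

(* Put Y = 0.6491 and normalise P_n to a polynomial p with p(0) = 1. The location of the roots rests
   on one comparison: if the coefficients of a power series e are nonpositive below index k and
   nonnegative above it, then e(x) / x^k is nondecreasing. With e = h - p, where
   h = 1 - x - x^2 - x^3 + x^5 + x^6 + ... and k = 4, uniqueness follows because h(x) / x^4 strictly
   decreases up to Y.

   For existence, p(gamma) <= eps * delta <= delta * (Y - gamma), so it suffices to show that
   p(Y) >= 0 forces p(gamma) > delta * (Y - gamma). Transversality is not available beyond
   gamma_high; instead, explicit polynomials bound delta from above, and the comparison bounds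
   p(gamma) from below. Near Y the comparison with h and k = 4 is too weak, since h(x) / x^4 is
   almost stationary there, and one distinguishes cases by the coefficients of p up to degree 4.

   In part (b), p has slope below -delta as soon as it is below delta. *)
theory Submission
  imports Defs
begin

section \<open>Comparison of power series whose coefficients change sign once\<close>

text \<open>Termwise: x^j y^k - y^j x^k is nonnegative for j < k and nonpositive for j > k, so its
  product with \<open>e j\<close> is never positive. It vanishes at j = k, which leaves
  \<open>e k\<close> free.\<close>

lemma power_series_quotient_mono:
  fixes e :: "nat \<Rightarrow> real"
  assumes x: "0 < x" and xy: "x \<le> y"
    and neg: "\<And>j. j < k \<Longrightarrow> e j \<le> 0" and pos: "\<And>j. j > k \<Longrightarrow> e j \<ge> 0"
    and s: "(\<lambda>j. e j * x ^ j) sums s" and t: "(\<lambda>j. e j * y ^ j) sums t"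
  shows "s * y ^ k \<le> t * x ^ k"
proof (rule sums_le[OF _ sums_mult2[OF s] sums_mult2[OF t]])
  fix j
  have "e j * (x ^ j * y ^ k - y ^ j * x ^ k) \<le> 0"
  proof (cases j k rule: linorder_cases)
    case less
    then obtain d where k: "k = j + d" by (metis less_imp_add_positive)
    have "x ^ j * y ^ k - y ^ j * x ^ k = x ^ j * y ^ j * (y ^ d - x ^ d)"
      by (simp add: k power_add algebra_simps)
    also have "\<dots> \<ge> 0"
      using x xy by (simp add: power_mono)
    finally show ?thesis using neg[OF less] by (simp add: mult_nonpos_nonneg)
  next
    case greater
    then obtain d where j: "j = k + d" by (metis less_imp_add_positive)
    have "x ^ j * y ^ k - y ^ j * x ^ k = x ^ k * y ^ k * (x ^ d - y ^ d)"
      by (simp add: j power_add algebra_simps)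
    also have "\<dots> \<le> 0"
      using x xy by (simp add: power_mono mult_nonneg_nonpos)
    finally show ?thesis using pos[OF greater] by (simp add: mult_nonneg_nonpos)
  qed auto
  then show "e j * x ^ j * y ^ k \<le> e j * y ^ j * x ^ k"
    by (simp add: algebra_simps)
qed

lemma poly_sums: "(\<lambda>j. coeff p j * x ^ j) sums poly p x" for p :: "real poly"
  unfolding poly_altdef
  by (rule sums_finite) (auto simp: coeff_eq_0)

lemma poly_quotient_mono:
  fixes p :: "real poly"
  assumes R: "\<And>z. \<bar>z\<bar> < 1 \<Longrightarrow> (\<lambda>j. r j * z ^ j) sums R z"
    and xy: "0 < x" "x \<le> y" "y < 1"
    and "\<And>j. j < k \<Longrightarrow> r j \<le> coeff p j" "\<And>j. j > k \<Longrightarrow> coeff p j \<le> r j"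
  shows "(R x - poly p x) * y ^ k \<le> (R y - poly p y) * x ^ k"
proof -
  have "(\<lambda>j. (r j - coeff p j) * z ^ j) sums (R z - poly p z)" if "\<bar>z\<bar> < 1" for z
    using sums_diff[OF R[OF that] poly_sums[of p z]] by (simp add: algebra_simps)
  from this[of x] this[of y] show ?thesis
    using assms by (intro power_series_quotient_mono[where e = "\<lambda>j. r j - coeff p j"]) auto
qed

section \<open>Transversality for polynomials and upper bounds on \<delta>\<close>

lemma transversality_poly:
  fixes p :: "real poly"
  assumes tr: "transversality d I" and x: "x \<in> I"
    and p0: "coeff p 0 = 1" and pj: "\<And>j. coeff p j \<in> {-1, 0, 1}"
    and less: "poly p x < d"
  shows "poly (pderiv p) x < - d"
proof -
  have eq: "unit_series (coeff p) = poly p"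
  proof
    fix z
    have "(\<lambda>j. coeff p (Suc j) * z ^ Suc j) sums (poly p z - 1)"
      using poly_sums[of p z] p0 by (subst sums_Suc_iff) simp
    then show "unit_series (coeff p) z = poly p z"
      by (simp add: unit_series_def sums_iff)
  qed
  have "unit_series (coeff p) x < d \<longrightarrow> deriv (unit_series (coeff p)) x < - d"
    using tr x pj unfolding transversality_def by blast
  then show ?thesis
    using less DERIV_imp_deriv[OF poly_DERIV[of p x]] by (simp add: eq)
qed

text \<open>If d were at least D, the value of p at x would be below d and its slope below -d, hence
  below -D. One explicit p thus bounds every admissible d from above.\<close>

lemma transversality_less_witness:
  fixes p :: "real poly"
  assumes "transversality d I" "x \<in> I" "coeff p 0 = 1" "\<And>j. coeff p j \<in> {-1, 0, 1}"
    and "poly p x < D" "poly (pderiv p) x \<ge> - D"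
  shows "d < D"
  using transversality_poly[OF assms(1-4)] assms(5,6) by linarith

lemma coeff_Poly_in:
  assumes "set cs \<subseteq> S" "0 \<in> S"
  shows "coeff (Poly cs) j \<in> S"
  using assms by (cases "j < length cs") (auto simp: nth_default_def)

text \<open>At 1/2 this witness has value about 0.4609 and slope about -0.4531. The points 1/2, 0.61
  and 0.645 of this and the next two bounds are the left ends of the ranges into which the root
  \<gamma> is later sorted, so they lie in [0, \<gamma>_high].\<close>

lemma transversality_bound_half:
  assumes "transversality d I" "1/2 \<in> I"
  shows "d < 0.461"
  by (rule transversality_less_witness[OF assms, where p = "Poly [1,-1,-1,1,1,0,1,1]"], simp,
      rule coeff_Poly_in, simp_all add: pderiv_pCons)

lemma transversality_bound_61:
  assumes "transversality d I" "0.61 \<in> I"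
  shows "d < 0.146"
  by (rule transversality_less_witness[OF assms, where p = "Poly [1,-1,-1,-1,1,1,1,1,1,1,1,1,1,1,1]"],
      simp, rule coeff_Poly_in, simp_all add: pderiv_pCons)

lemma transversality_bound_645:
  assumes "transversality d I" "0.645 \<in> I"
  shows "d < 0.08"
  by (rule transversality_less_witness[OF assms, where p = "Poly [1,-1,-1,-1,1,0,1,1,1,1,1,1,1,1,1,1]"],
      simp, rule coeff_Poly_in, simp_all add: pderiv_pCons)

section \<open>The comparison functions and their derivatives\<close>

text \<open>The functions \<open>star3\<close> and \<open>star4\<close> have coefficients \<open>1, -1, -1, -1, c, 1, 1, \<dots>\<close> with \<open>c = 0\<close>
  and \<open>c = 1\<close> respectively; for \<open>k = 4\<close> the value of \<open>c\<close> is immaterial.\<close>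

definition star3 :: "real \<Rightarrow> real" where
  "star3 x = 1 - x - x^2 - x^3 + x^5 / (1 - x)"

definition star4 :: "real \<Rightarrow> real" where
  "star4 x = 1 - x - x^2 - x^3 + x^4 / (1 - x)"

lemma sums_eventually_one:
  fixes x :: real
  assumes "\<bar>x\<bar> < 1"
  shows "(\<lambda>j. (if j < m then r j else 1) * x ^ j) sums ((\<Sum>j<m. r j * x ^ j) + x ^ m / (1 - x))"
proof -
  have "(\<lambda>i. x ^ m * x ^ i) sums (x ^ m * (1 / (1 - x)))"
    using assms by (intro sums_mult geometric_sums) auto
  then have "(\<lambda>i. (if i + m < m then r (i + m) else 1) * x ^ (i + m)) sums (x ^ m / (1 - x))"
    by (simp add: power_add mult.commute)
  then show ?thesis
    by (subst (asm) sums_iff_shift) (simp add: add.commute)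
qed

definition star3_coeff :: "nat \<Rightarrow> real" where
  "star3_coeff j = (if j < 5 then (if j = 0 then 1 else if j = 4 then 0 else - 1) else 1)"

definition star4_coeff :: "nat \<Rightarrow> real" where
  "star4_coeff j = (if j < 4 then (if j = 0 then 1 else - 1) else 1)"

lemma sums_star3: "\<bar>x\<bar> < 1 \<Longrightarrow> (\<lambda>j. star3_coeff j * x ^ j) sums star3 x"
  using sums_eventually_one[of x 5 "\<lambda>j. if j = 0 then 1 else if j = 4 then 0 else - 1"]
  by (simp add: star3_coeff_def star3_def eval_nat_numeral algebra_simps)

lemma sums_star4: "\<bar>x\<bar> < 1 \<Longrightarrow> (\<lambda>j. star4_coeff j * x ^ j) sums star4 x"
  using sums_eventually_one[of x 4 "\<lambda>j. if j = 0 then 1 else - 1"]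
  by (simp add: star4_coeff_def star4_def eval_nat_numeral algebra_simps)

text \<open>Writing the last term as x^4 times a bracket that increases on [0,1) makes the growth of
  \<open>dstar3 x / x^2\<close> visible.\<close>

definition dstar3 :: "real \<Rightarrow> real" where
  "dstar3 x = - 1 - 2 * x - 3 * x^2 + x^4 * (4 / (1 - x) + 1 / (1 - x)^2)"

lemma DERIV_star3:
  assumes "x < 1" shows "(star3 has_real_derivative dstar3 x) (at x)"
proof -
  have *: "(5 * x^4 * (1 - x) + x^5) / ((1 - x) * (1 - x)) = x^4 * (4 / (1 - x) + 1 / (1 - x)^2)"
    using assms by (simp add: divide_simps power2_eq_square) algebra
  show ?thesis unfolding star3_def[abs_def] dstar3_def *[symmetric] using assms
    by (auto intro!: derivative_eq_intros)
qed

definition dstar4 :: "real \<Rightarrow> real" where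
  "dstar4 x = - 1 - 2 * x - 3 * x^2 + x^3 * (3 / (1 - x) + 1 / (1 - x)^2)"

lemma DERIV_star4:
  assumes "x < 1" shows "(star4 has_real_derivative dstar4 x) (at x)"
proof -
  have *: "(4 * x^3 * (1 - x) + x^4) / ((1 - x) * (1 - x)) = x^3 * (3 / (1 - x) + 1 / (1 - x)^2)"
    using assms by (simp add: divide_simps power2_eq_square) algebra
  show ?thesis unfolding star4_def[abs_def] dstar4_def *[symmetric] using assms
    by (auto intro!: derivative_eq_intros)
qed

section \<open>Strict decrease of the quotients by powers\<close>

text \<open>The derivative of f(z) / z^k is (z f'(z) - k f(z)) / z^(k+1).\<close>

lemma quotient_power_strict_antimono:
  fixes f :: "real \<Rightarrow> real"
  assumes xy: "0 < x" "x < y"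
    and der: "\<And>z. x \<le> z \<Longrightarrow> z \<le> y \<Longrightarrow> (f has_real_derivative f' z) (at z)"
    and less: "\<And>z. x \<le> z \<Longrightarrow> z \<le> y \<Longrightarrow> z * f' z < real k * f z"
  shows "f y * x ^ k < f x * y ^ k"
proof -
  have "f y / y ^ k < f x / x ^ k"
  proof (rule DERIV_neg_imp_decreasing[OF xy(2)])
    fix z assume z: "x \<le> z" "z \<le> y"
    then have z0: "z > 0" using xy by simp
    have "((\<lambda>z. f z / z ^ k) has_real_derivative
        (f' z * z ^ k - f z * (real k * z ^ (k - 1))) / (z ^ k * z ^ k)) (at z)"
      using z0 by (auto intro!: derivative_eq_intros der z simp: mult_ac)
    moreover have "(f' z * z ^ k - f z * (real k * z ^ (k - 1))) * z = (z * f' z - real k * f z) * z ^ k"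
      by (cases k) (simp_all add: algebra_simps)
    then have "(f' z * z ^ k - f z * (real k * z ^ (k - 1))) * z < 0"
      using less[OF z] z0 by (simp add: mult_neg_pos)
    then have "(f' z * z ^ k - f z * (real k * z ^ (k - 1))) / (z ^ k * z ^ k) < 0"
      using z0 by (simp add: mult_less_0_iff divide_neg_pos)
    ultimately show "\<exists>D. ((\<lambda>z. f z / z ^ k) has_real_derivative D) (at z) \<and> D < 0"
      by blast
  qed
  then show ?thesis
    using xy by (simp add: field_simps)
qed

lemma star3_quotient:
  assumes xy: "0 < x" "x < y" "y \<le> 0.6491"
  shows "star3 y * x^4 < star3 x * y^4"
proof (rule quotient_power_strict_antimono[OF xy(1,2)])
  fix z assume z: "x \<le> z" "z \<le> y"
  then have z': "0 < z" "z \<le> 0.6491" using xy by auto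
  show "(star3 has_real_derivative dstar3 z) (at z)"
    using z' by (intro DERIV_star3) auto
  define u where "u = 1 / (1 - z)"
  \<comment> \<open>Every nonconstant term on the right increases with z, so the right end 0.6491
    decides. The value there is about -0.0007, so 0.6491 is almost the largest bound this argument
    permits.\<close>
  have eq: "z * dstar3 z - 4 * star3 z = - 4 + 3 * z + 2 * z^2 + z^3 + z^5 * u^2"
    unfolding dstar3_def star3_def
    by (simp add: u_def algebra_simps eval_nat_numeral)
  have "u \<le> 1 / (1 - 0.6491)"
    using z' unfolding u_def by (intro frac_le) auto
  moreover have "u \<ge> 0"
    using z' unfolding u_def by simp
  ultimately have "z^5 * u^2 \<le> 0.6491^5 * (1 / (1 - 0.6491))^2"
    using z' by (intro mult_mono power_mono) auto
  moreover have "z^2 \<le> 0.6491^2" "z^3 \<le> 0.6491^3"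
    using z' by (intro power_mono; simp)+
  ultimately show "z * dstar3 z < real 4 * star3 z"
    using eq z' by (simp add: power_divide)
qed

text \<open>Subtracting \<open>0.0247\<close> makes the decrease of \<open>star4 x / x^5\<close> quantitative.\<close>

lemma star4_quotient:
  assumes xy: "0.61 \<le> x" "x < y" "y \<le> 0.6491"
  shows "(star4 y - 0.0247) * x^5 < (star4 x - 0.0247) * y^5"
proof (rule quotient_power_strict_antimono)
  show "0 < x" "x < y" using xy by auto
  fix z assume z: "x \<le> z" "z \<le> y"
  then have z': "0.61 \<le> z" "z \<le> 0.6491" using xy by auto
  show "((\<lambda>z. star4 z - 0.0247) has_real_derivative dstar4 z) (at z)"
    using z' DERIV_star4[of z] by (auto intro!: derivative_eq_intros)
  define u where "u = 1 / (1 - z)"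
  have zu: "z * u = u - 1"
    using z' by (simp add: u_def field_simps)
  have "z * dstar4 z - 5 * star4 z = - 5 + 4 * z + 3 * z^2 + 2 * z^3 + z^4 * (u^2 - 2 * u)"
    unfolding dstar4_def star4_def
    by (simp add: u_def algebra_simps eval_nat_numeral)
  \<comment> \<open>This is (z u)^2 = (u - 1)^2. It leaves -z^4 as the only decreasing term;
    bounding that one at 0.61 and the others at 0.6491 gives about -0.1237, just below -5 *
    0.0247.\<close>
  also have "u^2 - 2 * u = z^2 * u^2 - 1"
    unfolding power_mult_distrib[symmetric] zu by (simp add: power2_eq_square algebra_simps)
  finally have eq: "z * dstar4 z - 5 * star4 z = - 5 + 4 * z + 3 * z^2 + 2 * z^3 + z^6 * u^2 - z^4"
    by (simp add: algebra_simps eval_nat_numeral)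
  have "u \<le> 1 / (1 - 0.6491)"
    using z' unfolding u_def by (intro frac_le) auto
  moreover have "u \<ge> 0"
    using z' unfolding u_def by simp
  ultimately have "z^6 * u^2 \<le> 0.6491^6 * (1 / (1 - 0.6491))^2"
    using z' by (intro mult_mono power_mono) auto
  moreover have "z^2 \<le> 0.6491^2" "z^3 \<le> 0.6491^3"
    using z' by (intro power_mono; simp)+
  moreover have "z^4 \<ge> 0.61^4"
    using z' by (intro power_mono) auto
  ultimately show "z * dstar4 z < real 5 * (star4 z - 0.0247)"
    using eq z' by (simp add: power_divide)
qed

section \<open>Lower bounds for the descent of \<open>star3\<close>\<close>

text \<open>After division by x^2 the terms -1/x^2 and -2/x increase, -3 is constant, and x^2 times
  the increasing bracket increases.\<close>

lemma dstar3_quotient: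
  assumes "0 < x" "x \<le> u" "u < 1"
  shows "dstar3 x * u^2 \<le> dstar3 u * x^2"
proof -
  define t where "t z = 4 / (1 - z) + 1 / (1 - z)^2" for z :: real
  have t: "0 \<le> t x" "t x \<le> t u"
    using assms unfolding t_def by (auto intro!: add_mono frac_le power_mono)
  have "x^4 * t x * u^2 = (x^2 * u^2) * (x^2 * t x)"
    by (simp add: eval_nat_numeral)
  also have "\<dots> \<le> (x^2 * u^2) * (u^2 * t u)"
    using assms t by (intro mult_left_mono mult_mono power_mono) auto
  also have "\<dots> = u^4 * t u * x^2"
    by (simp add: eval_nat_numeral)
  finally have "x^4 * t x * u^2 \<le> u^4 * t u * x^2" .
  moreover have "x^2 \<le> u^2"
    using assms by (intro power_mono) auto
  moreover have "u * x^2 \<le> x * u^2"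
    using assms by (simp add: power2_eq_square mult_mono)
  ultimately show ?thesis
    unfolding dstar3_def t_def by (simp add: algebra_simps)
qed

text \<open>By \<open>dstar3_quotient\<close>, one evaluation at the right end u bounds the slope on
  all of [l, u] by -s l^2; the mean value theorem then applies.\<close>

lemma star3_drop:
  assumes "0 < l" "l \<le> a" "a \<le> u" "u < 1" and s: "dstar3 u \<le> - s * u^2" "s \<ge> 0"
    and m: "m \<le> s * l^2"
  shows "star3 u + m * (u - a) \<le> star3 a"
proof (cases "a = u")
  case False
  then obtain z where z: "a < z" "z < u" "star3 u - star3 a = (u - a) * dstar3 z"
    using MVT2[of a u star3 dstar3] assms DERIV_star3 by (metis le_less order_le_less_trans)
  have u2: "u^2 > 0"
    using assms by auto
  have "dstar3 z * u^2 \<le> dstar3 u * z^2"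
    using z assms by (intro dstar3_quotient) auto
  also have "\<dots> \<le> (- s * u^2) * z^2"
    using s by (intro mult_right_mono) auto
  finally have "dstar3 z * u^2 \<le> (- s * z^2) * u^2"
    by (simp add: mult_ac)
  then have "dstar3 z \<le> - s * z^2"
    using u2 by (meson mult_le_cancel_right_pos)
  moreover have "s * l^2 \<le> s * z^2"
    using assms z by (intro mult_left_mono power_mono) auto
  ultimately have "(u - a) * dstar3 z \<le> (u - a) * (- m)"
    using assms by (intro mult_left_mono) auto
  then show ?thesis
    using z(3) by (simp add: algebra_simps)
qed simp

lemma star3_drop_61:
  assumes "1/2 \<le> a" "a \<le> 0.61"
  shows "0.0074 + 0.67 * (0.61 - a) \<le> star3 a"
proof -
  have "star3 0.61 + 0.67 * (0.61 - a) \<le> star3 a"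
    using assms by (intro star3_drop[where l = "1/2" and s = "2.7"]) (auto simp: dstar3_def power_divide)
  moreover have "0.0074 \<le> star3 0.61"
    by (simp add: star3_def power_divide)
  ultimately show ?thesis by argo
qed

lemma star3_drop_645:
  assumes "0.61 \<le> a" "a \<le> 0.645"
  shows "star3 0.6491 + 0.146 * (0.6491 - a) \<le> star3 a"
proof -
  have "star3 0.645 + 0.146 * (0.645 - a) \<le> star3 a"
    using assms by (intro star3_drop[where l = "0.61" and s = "0.51"]) (auto simp: dstar3_def power_divide)
  \<comment> \<open>The slope flattens to about -0.097 at 0.6491, so on this last stretch only the
    average slope reaches -0.146; it is checked from the two end values.\<close>
  moreover have "star3 0.6491 + 0.146 * (0.6491 - 0.645) \<le> star3 0.645"
    by (simp add: star3_def power_divide)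
  ultimately show ?thesis by argo
qed

lemma star3_drop_6491:
  assumes "0.645 \<le> a" "a \<le> 0.6491"
  shows "star3 0.6491 + 0.08 * (0.6491 - a) \<le> star3 a"
  using assms by (intro star3_drop[where l = "0.645" and s = "0.22"]) (auto simp: dstar3_def power_divide)

lemma star3_6491_less: "star3 0.6491 \<le> - 0.0155"
  by (simp add: star3_def power_divide)

section \<open>Uniqueness of the root and lower bounds for p to the left of 0.6491\<close>

lemma poly_star3_quotient:
  fixes p :: "real poly"
  assumes p0: "coeff p 0 = 1" and pj: "\<And>j. coeff p j \<in> {-1, 0, 1}"
    and "0 < x" "x \<le> y" "y < 1"
  shows "(star3 x - poly p x) * y^4 \<le> (star3 y - poly p y) * x^4"
proof (rule poly_quotient_mono[OF sums_star3])
  show "star3_coeff j \<le> coeff p j" if "j < 4" for j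
    using pj[of j] p0 that by (auto simp: star3_coeff_def)
  show "coeff p j \<le> star3_coeff j" if "j > 4" for j
    using pj[of j] that by (auto simp: star3_coeff_def)
qed (use assms in auto)

text \<open>Two roots x < y would turn the comparison into star3(x) y^4 <= star3(y) x^4, against
  \<open>star3_quotient\<close>.\<close>

lemma unit_poly_root_unique:
  fixes p :: "real poly"
  assumes p0: "coeff p 0 = 1" and pj: "\<And>j. coeff p j \<in> {-1, 0, 1}"
    and "x \<in> {0..0.6491}" "y \<in> {0..0.6491}" "poly p x = 0" "poly p y = 0"
  shows "x = y"
proof -
  have False if xy: "x < y" "x \<in> {0..0.6491}" "y \<in> {0..0.6491}" "poly p x = 0" "poly p y = 0" for x y
  proof -
    have "x \<noteq> 0"
      using xy(4) p0 by (auto simp: poly_0_coeff_0)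
    then have "0 < x" using xy by auto
    then show False
      using poly_star3_quotient[OF p0 pj, of x y] star3_quotient[of x y] xy by auto
  qed
  then show ?thesis
    using assms(3-) by (metis linorder_neqE_linordered_idom)
qed

lemma unit_poly_drop_low:
  fixes p :: "real poly"
  assumes p0: "coeff p 0 = 1" and pj: "\<And>j. coeff p j \<in> {-1, 0, 1}"
    and a: "1/2 \<le> a" "a \<le> 0.61" and pos: "poly p 0.6491 \<ge> 0"
  shows "0.461 * (0.6491 - a) < poly p a"
proof -
  define q where "q = a / 0.6491"
  have "(star3 a - poly p a) * 0.6491^4 \<le> (star3 0.6491 - poly p 0.6491) * a^4"
    using a by (intro poly_star3_quotient[OF p0 pj]) auto
  then have "star3 a - poly p a \<le> (star3 0.6491 - poly p 0.6491) * q^4"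
    by (simp add: q_def power_divide field_simps)
  also have "\<dots> \<le> - 0.0155 * q^4"
    using star3_6491_less pos by (intro mult_right_mono) auto
  finally have "star3 a + 0.0155 * q^4 \<le> poly p a" by simp
  \<comment> \<open>Bernoulli gives q^4 >= 4 q - 3, and 4 / 0.6491 exceeds 6.16. All bounds are now
    linear in a.\<close>
  moreover have "6.16 * a - 3 \<le> q^4"
    using Bernoulli_inequality[of "q - 1" 4] a by (simp add: q_def)
  then have "0.0155 * (6.16 * a - 3) \<le> 0.0155 * q^4"
    by simp
  moreover have "0.0074 + 0.67 * (0.61 - a) \<le> star3 a"
    by (rule star3_drop_61[OF a])
  ultimately show ?thesis
    using a by (simp add: field_simps)
qed

text \<open>The cases: \<open>prefix\<close>, where \<open>star3\<close> dominates p
  coefficientwise; \<open>plus\<close>, where the sign change moves up to k = 5; and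
  \<open>deviation\<close>, where an early coefficient exceeds -1 and leaves a monomial to
  spare.\<close>

lemma unit_poly_drop_high:
  fixes p :: "real poly"
  assumes p0: "coeff p 0 = 1" and pj: "\<And>j. coeff p j \<in> {-1, 0, 1}"
    and a: "0.61 \<le> a" "a < 0.6491" and pos: "poly p 0.6491 \<ge> 0"
    and d: "d < 0.146" "0.645 \<le> a \<Longrightarrow> d < 0.08"
  shows "d * (0.6491 - a) < poly p a"
proof -
  consider (prefix) "\<And>j. j \<in> {1,2,3} \<Longrightarrow> coeff p j = -1" "coeff p 4 \<le> 0"
    | (plus) "coeff p 4 = 1"
    | (deviation) j where "j \<in> {1,2,3}" "coeff p j \<ge> 0"
  proof (cases "\<exists>j\<in>{1,2,3}. coeff p j \<ge> 0")
    case False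
    then have "coeff p j = -1" if "j \<in> {1,2,3}" for j
      using pj[of j] that by fastforce
    then show ?thesis
      using pj[of 4] that(1,2) by auto
  next
    case True
    then obtain j where "j \<in> {1,2,3}" "coeff p j \<ge> 0" by blast
    then show ?thesis by (rule that(3))
  qed
  then show ?thesis
  proof cases
    case prefix
    \<comment> \<open>With exponent 0 the comparison says that \<open>star3\<close> - p is
      nondecreasing, so p falls at least as much as \<open>star3\<close>.\<close>
    have "(star3 a - poly p a) * 0.6491^0 \<le> (star3 0.6491 - poly p 0.6491) * a^0"
    proof (rule poly_quotient_mono[OF sums_star3])
      show "coeff p j \<le> star3_coeff j" if "j > 0" for j
      proof -
        consider "j \<in> {1,2,3}" | "j = 4" | "j \<ge> 5" using \<open>j > 0\<close> by fastforce
        then show ?thesis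
        proof cases
          case 1
          then show ?thesis using prefix(1)[OF 1] by (auto simp: star3_coeff_def)
        next
          case 2
          then show ?thesis using prefix(2) by (simp add: star3_coeff_def)
        next
          case 3
          then show ?thesis using pj[of j] by (auto simp: star3_coeff_def)
        qed
      qed
    qed (use a in auto)
    then have "star3 a - star3 0.6491 \<le> poly p a"
      using pos by simp
    moreover have "d * (0.6491 - a) < star3 a - star3 0.6491"
    proof (cases "a \<ge> 0.645")
      case True
      have "d * (0.6491 - a) < 0.08 * (0.6491 - a)"
        using d(2)[OF True] a by (intro mult_strict_right_mono) auto
      also have "\<dots> \<le> star3 a - star3 0.6491"
        using star3_drop_6491[of a] True a by (simp add: field_simps)
      finally show ?thesis .
    next
      case False
      have "d * (0.6491 - a) < 0.146 * (0.6491 - a)"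
        using d(1) a by (intro mult_strict_right_mono) auto
      also have "\<dots> \<le> star3 a - star3 0.6491"
        using star3_drop_645[of a] False a by (simp add: field_simps)
      finally show ?thesis .
    qed
    ultimately show ?thesis by simp
  next
    case plus
    have "(star4 a - poly p a) * 0.6491^5 \<le> (star4 0.6491 - poly p 0.6491) * a^5"
    proof (rule poly_quotient_mono[OF sums_star4])
      show "star4_coeff j \<le> coeff p j" if "j < 5" for j
        using pj[of j] p0 plus that by (cases "j = 4") (auto simp: star4_coeff_def)
      show "coeff p j \<le> star4_coeff j" if "j > 5" for j
        using pj[of j] that by (auto simp: star4_coeff_def)
    qed (use a in auto)
    moreover have "(star4 0.6491 - 0.0247) * a^5 < (star4 a - 0.0247) * 0.6491^5"
      using a by (intro star4_quotient) auto
    moreover have "poly p 0.6491 * a^5 \<ge> 0"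
      using pos a by simp
    ultimately have "0.0247 * (0.6491^5 - a^5) < poly p a * 0.6491^5"
      by (simp only: algebra_simps)
    \<comment> \<open>Y^5 - a^5 is Y - a times five monomials of degree 4, each at least
      0.61^4.\<close>
    moreover have "(5 * 0.61^4) * (0.6491 - a) \<le> 0.6491^5 - a^5"
    proof -
      define Y :: real where "Y = 0.6491"
      have *: "0.61^4 \<le> Y^i * a^j" if "i + j = 4" for i j
      proof -
        have "(0.61::real)^4 = 0.61^i * 0.61^j" by (simp flip: power_add add: that)
        also have "\<dots> \<le> Y^i * a^j"
          using a by (intro mult_mono power_mono) (auto simp: Y_def)
        finally show ?thesis .
      qed
      have "5 * 0.61^4 \<le> Y^4 + Y^3 * a + Y^2 * a^2 + Y * a^3 + a^4"
        using *[of 4 0] *[of 3 1] *[of 2 2] *[of 1 3] *[of 0 4] by simp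
      then have "(5 * 0.61^4) * (Y - a) \<le> (Y^4 + Y^3 * a + Y^2 * a^2 + Y * a^3 + a^4) * (Y - a)"
        using a by (intro mult_right_mono) (auto simp: Y_def)
      also have "\<dots> = Y^5 - a^5"
        by (simp add: algebra_simps eval_nat_numeral)
      finally show ?thesis by (simp only: Y_def)
    qed
    then have "0.0247 * ((5 * 0.61^4) * (0.6491 - a)) \<le> 0.0247 * (0.6491^5 - a^5)"
      by (rule mult_left_mono) simp
    ultimately have "0.0247 * ((5 * 0.61^4) * (0.6491 - a)) < poly p a * 0.6491^5"
      by (rule order.strict_trans1[rotated])
    moreover have "0.146 * 0.6491^5 * (0.6491 - a) \<le> 0.0247 * (5 * 0.61^4) * (0.6491 - a)"
      using a by (intro mult_right_mono) (auto simp: power_divide)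
    ultimately have "(0.146 * (0.6491 - a)) * 0.6491^5 < poly p a * 0.6491^5"
      by (simp only: mult_ac)
    then have "0.146 * (0.6491 - a) < poly p a"
      by (rule mult_right_less_imp_less) simp
    moreover have "d * (0.6491 - a) < 0.146 * (0.6491 - a)"
      using d(1) a by (intro mult_strict_right_mono) auto
    ultimately show ?thesis by (rule order.strict_trans[rotated])
  next
    case (deviation j)
    define Y :: real where "Y = 0.6491"
    \<comment> \<open>Lowering the coefficient at \<open>j\<close> by 1 preserves the sign pattern; the removed monomial is the gain.\<close>
    define q where "q = p - monom 1 j"
    have "(star3 a - poly q a) * Y^4 \<le> (star3 Y - poly q Y) * a^4"
    proof (rule poly_quotient_mono[OF sums_star3])
      show "star3_coeff i \<le> coeff q i" if "i < 4" for i
        using pj[of i] p0 that deviation by (auto simp: star3_coeff_def q_def)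
      show "coeff q i \<le> star3_coeff i" if "i > 4" for i
        using pj[of i] that deviation by (auto simp: star3_coeff_def q_def)
    qed (use a in \<open>auto simp: Y_def\<close>)
    moreover have "star3 Y * a^4 < star3 a * Y^4"
      using star3_quotient[of a Y] a by (simp add: Y_def)
    moreover have "poly p Y * a^4 \<ge> 0"
      using pos a by (simp add: Y_def)
    ultimately have "a^j * Y^4 - Y^j * a^4 < poly p a * Y^4"
      by (simp add: q_def poly_monom algebra_simps)
    \<comment> \<open>The right side is a^j Y^j (Y^(4-j) - a^(4-j)). Since a and Y are below 1, it
      is smallest for j = 3, where equality holds.\<close>
    moreover have "a^3 * Y^3 * (Y - a) \<le> a^j * Y^4 - Y^j * a^4"
    proof -
      have aY: "0 \<le> a * Y" "a * Y \<le> a" "a \<le> a + Y" "a^2 * Y^2 \<le> a * Y" "0 \<le> Y - a"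
        using a by (auto simp: Y_def mult_le_one power2_eq_square mult_left_le mult_le_cancel_left1)
      consider "j = 1" | "j = 2" | "j = 3" using deviation by auto
      then show ?thesis
      proof cases
        case 1
        have "(a * Y) * (a^2 * Y^2) * (Y - a) \<le> (a * Y) * (a^2 + a * Y + Y^2) * (Y - a)"
          using aY zero_le_power2[of a] zero_le_power2[of Y]
          by (intro mult_left_mono mult_right_mono) linarith+
        then show ?thesis by (simp add: 1 algebra_simps eval_nat_numeral)
      next
        case 2
        have "(a * Y)^2 * (a * Y) * (Y - a) \<le> (a * Y)^2 * (a + Y) * (Y - a)"
          using aY by (intro mult_left_mono mult_right_mono) auto
        then show ?thesis by (simp add: 2 algebra_simps eval_nat_numeral)
      qed (simp add: algebra_simps eval_nat_numeral)
    qed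
    ultimately have "a^3 * (Y - a) * Y^3 < poly p a * Y * Y^3"
      by (simp add: algebra_simps eval_nat_numeral)
    then have "a^3 * (Y - a) < poly p a * Y"
      by (rule mult_right_less_imp_less) (simp add: Y_def)
    moreover have "0.146 * Y \<le> a^3"
      using power_mono[of "0.61" a 3] a by (simp add: Y_def power_divide)
    then have "0.146 * Y * (Y - a) \<le> a^3 * (Y - a)"
      using a by (intro mult_right_mono) (auto simp: Y_def)
    ultimately have "0.146 * Y * (Y - a) < poly p a * Y"
      by linarith
    then have "0.146 * (Y - a) * Y < poly p a * Y"
      by (simp only: mult_ac)
    then have "0.146 * (Y - a) < poly p a"
      by (rule mult_right_less_imp_less) (simp add: Y_def)
    moreover have "d * (Y - a) \<le> 0.146 * (Y - a)"
      using d(1) a by (intro mult_right_mono) (auto simp: Y_def)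
    ultimately show ?thesis by (simp add: Y_def)
  qed
qed

section \<open>Estimates at the root of the series and descent below \<delta>\<close>

text \<open>Adding the geometric series makes all terms nonnegative and the first one 2, so 2 <= 1 /
  (1 - x).\<close>

lemma unit_series_root_ge_half:
  fixes c :: "nat \<Rightarrow> real"
  assumes c0: "c 0 = 1" and cj: "\<And>j. c j \<in> {-1, 0, 1}"
    and x: "0 < x" "x < 1" and root: "(\<lambda>j. c j * x ^ j) sums 0"
  shows "1/2 \<le> x"
proof -
  have "(\<lambda>j. (if j = 0 then 2 else 0) :: real) sums 2"
    using sums_single[of 0 "\<lambda>_. 2 :: real"] by simp
  moreover have "(\<lambda>j. c j * x ^ j + x ^ j) sums (0 + 1 / (1 - x))"
    using x by (intro sums_add root geometric_sums) auto
  moreover have "(if j = 0 then 2 else 0) \<le> c j * x ^ j + x ^ j" for j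
    using cj[of j] c0 x by auto
  ultimately have "2 \<le> 0 + 1 / (1 - x)"
    by (rule sums_le[rotated])
  then show ?thesis using x by (simp add: field_simps)
qed

text \<open>At a root the partial sum is minus the tail, which a geometric series dominates.\<close>

lemma partial_sum_bound_at_root:
  fixes c :: "nat \<Rightarrow> real"
  assumes cj: "\<And>j. \<bar>c j\<bar> \<le> 1" and x: "0 \<le> x" "x < 1"
    and root: "(\<lambda>j. c j * x ^ j) sums 0"
  shows "\<bar>\<Sum>j\<le>n. c j * x ^ j\<bar> \<le> x ^ Suc n / (1 - x)"
proof -
  have tail: "(\<lambda>j. c (j + Suc n) * x ^ (j + Suc n)) sums (- (\<Sum>j\<le>n. c j * x ^ j))"
    using root by (subst sums_iff_shift) (simp add: lessThan_Suc_atMost)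
  have geo: "(\<lambda>j. x ^ Suc n * x ^ j) sums (x ^ Suc n * (1 / (1 - x)))"
    using x by (intro sums_mult geometric_sums) auto
  have le: "\<bar>c (j + Suc n) * x ^ (j + Suc n)\<bar> \<le> x ^ Suc n * x ^ j" for j
    using mult_right_mono[OF cj[of "j + Suc n"], of "x ^ (j + Suc n)"] x
    by (simp add: abs_mult power_add mult_ac)
  have "- (\<Sum>j\<le>n. c j * x ^ j) \<le> x ^ Suc n * (1 / (1 - x))"
    using le by (intro sums_le[OF _ tail geo]) (meson abs_le_D1)
  moreover have "- (- (\<Sum>j\<le>n. c j * x ^ j)) \<le> x ^ Suc n * (1 / (1 - x))"
    using le by (intro sums_le[OF _ sums_minus[OF tail] geo]) (meson abs_le_D2)
  ultimately show ?thesis by simp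
qed

lemma drop_ge_if_deriv_less_below:
  fixes f :: "real \<Rightarrow> real"
  assumes uv: "u \<le> v" and fu: "f u < d" and d: "d > 0"
    and der: "\<And>z. u \<le> z \<Longrightarrow> z \<le> v \<Longrightarrow> (f has_real_derivative f' z) (at z)"
    and tr: "\<And>z. u \<le> z \<Longrightarrow> z \<le> v \<Longrightarrow> f z < d \<Longrightarrow> f' z < - d"
  shows "d * (v - u) \<le> f u - f v"
proof -
  \<comment> \<open>Once below d, f stays below d: a minimiser on [u, z] other than z would have
    negative slope, hence smaller values just to its right.\<close>
  have below: "f z < d" if z: "u \<le> z" "z \<le> v" for z
  proof -
    have "continuous_on {u..z} f"
      using der z by (meson DERIV_isCont atLeastAtMost_iff continuous_at_imp_continuous_on order_trans)
    then obtain t where t: "u \<le> t" "t \<le> z" and tmin: "\<And>w. u \<le> w \<Longrightarrow> w \<le> z \<Longrightarrow> f t \<le> f w"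
      using continuous_attains_inf[of "{u..z}" f] z by auto
    have "f t < d"
      using tmin[of u] fu z by auto
    have "t = z"
    proof (rule ccontr)
      assume "t \<noteq> z"
      have "f' t < 0"
        using tr[of t] t z d \<open>f t < d\<close> by force
      then obtain e where e: "e > 0" "\<And>h. h > 0 \<Longrightarrow> h < e \<Longrightarrow> f (t + h) < f t"
        using DERIV_neg_dec_right[OF der[of t]] t z by auto
      have "f (t + min (e / 2) (z - t)) < f t"
        using e t \<open>t \<noteq> z\<close> by (intro e(2)) auto
      moreover have "f t \<le> f (t + min (e / 2) (z - t))"
        using e t by (intro tmin) auto
      ultimately show False by simp
    qed
    then show ?thesis using \<open>f t < d\<close> by simp
  qed
  show ?thesis
  proof (cases "u = v")
    case False
    then obtain z where z: "u < z" "z < v" "f v - f u = (v - u) * f' z"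
      using MVT2[of u v f f'] der uv by (metis less_eq_real_def)
    have "(v - u) * f' z \<le> (v - u) * (- d)"
      using tr[of z] below[of z] z by (intro mult_left_mono) auto
    then show ?thesis using z(3) by (simp add: algebra_simps)
  qed simp
qed

theorem theorem1p2p10:
  fixes b :: "nat \<Rightarrow> real"
    and \<gamma> \<gamma>_low \<gamma>_high \<epsilon> \<delta> :: real
    and N :: int
    and n :: nat
  assumes b0: "b 0 \<in> {-1, 1}"
    and bj: "\<And>j. j \<ge> 1 \<Longrightarrow> b j \<in> {-1, 0, 1}"
    and low_pos: "0 < \<gamma>_low"
    and low_le_high: "\<gamma>_low \<le> \<gamma>_high"
    and eps_pos: "\<epsilon> > 0"
    and high_eq: "\<gamma>_high = 0.6491 - \<epsilon>"
    and gamma_in: "\<gamma> \<in> {\<gamma>_low..\<gamma>_high}"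
    and gamma_root: "(\<Sum>j. b j * \<gamma> ^ j) = 0"
    and delta_pos: "\<delta> > 0"
    and transv: "transversality \<delta> {0..\<gamma>_high}"
    and N_bound: "\<gamma> powi (N + 1) \<le> \<epsilon> * \<delta> * (1 - \<gamma>)"
    and N_least: "\<And>M :: int. \<gamma> powi (M + 1) \<le> \<epsilon> * \<delta> * (1 - \<gamma>) \<Longrightarrow> N \<le> M"
    and n_ge: "int n \<ge> N"
  shows "(\<exists>!\<gamma>\<^sub>n. \<gamma>\<^sub>n \<in> {0..0.6491} \<and> (\<Sum>j\<le>n. b j * \<gamma>\<^sub>n ^ j) = 0) \<and>
         (\<forall>\<gamma>'\<in>{\<gamma>_low..\<gamma>_high}. \<bar>\<Sum>j\<le>n. b j * \<gamma>' ^ j\<bar> \<le> \<gamma>_low ^ n \<longrightarrow>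
            \<bar>\<gamma>' - \<gamma>\<bar> \<le> (1 / (\<delta> * (1 - \<gamma>))) * \<gamma> ^ n)"
proof -
  define c where "c j = b 0 * b j" for j
  define p where "p = (\<Sum>j\<le>n. monom (c j) j)"
  have b_cases: "b j \<in> {-1, 0, 1}" for j
    using b0 bj[of j] by (cases "j = 0") auto
  have c0: "c 0 = 1" and cj: "c j \<in> {-1, 0, 1}" for j
    using b0 b_cases[of j] by (auto simp: c_def)
  have coeff_p: "coeff p j = (if j \<le> n then c j else 0)" for j
    by (simp add: p_def coeff_sum)
  then have p0: "coeff p 0 = 1" and pj: "coeff p j \<in> {-1, 0, 1}" for j
    using c0 cj[of j] by auto
  have poly_p: "poly p x = (\<Sum>j\<le>n. c j * x ^ j)" for x
    by (simp add: p_def poly_sum poly_monom)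
  have P: "(\<Sum>j\<le>n. b j * x ^ j) = b 0 * poly p x" for x
    using b0 by (auto simp: poly_p c_def sum_distrib_left)
  have g: "0 < \<gamma>" "\<gamma> < 0.6491" "\<gamma> \<le> \<gamma>_high" "\<gamma> < 1" "\<epsilon> \<le> 0.6491 - \<gamma>"
    using gamma_in low_pos high_eq eps_pos by auto
  have sums: "(\<lambda>j. c j * \<gamma> ^ j) sums 0"
  proof -
    have "summable (\<lambda>j. b j * \<gamma> ^ j)"
    proof (rule summable_comparison_test'[of "\<lambda>j. \<gamma> ^ j" 0])
      show "summable (\<lambda>j. \<gamma> ^ j)" using g by (intro summable_geometric) auto
      show "norm (b j * \<gamma> ^ j) \<le> \<gamma> ^ j" for j using b_cases[of j] g by (auto simp: abs_mult)
    qed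
    then have "(\<lambda>j. b j * \<gamma> ^ j) sums 0"
      using gamma_root by (simp add: sums_iff)
    from sums_mult[OF this, of "b 0"] show ?thesis by (simp add: c_def mult.assoc)
  qed
  have half: "1/2 \<le> \<gamma>"
    by (rule unit_series_root_ge_half[OF c0 cj g(1,4) sums])
  have "\<gamma> ^ Suc n = \<gamma> powi (int n + 1)"
    using power_int_of_nat[of \<gamma> "Suc n"] by (simp add: add.commute)
  also have "\<dots> \<le> \<gamma> powi (N + 1)"
    using g n_ge by (intro power_int_decreasing) auto
  finally have pow: "\<gamma> ^ Suc n \<le> \<epsilon> * \<delta> * (1 - \<gamma>)"
    using N_bound by simp
  have "\<bar>poly p \<gamma>\<bar> \<le> \<gamma> ^ Suc n / (1 - \<gamma>)"
    unfolding poly_p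
  proof (rule partial_sum_bound_at_root[OF _ _ _ sums])
    show "\<bar>c j\<bar> \<le> 1" for j using cj[of j] by auto
  qed (use g in auto)
  moreover have "\<gamma> ^ Suc n / (1 - \<gamma>) \<le> \<epsilon> * \<delta>"
    using pow g by (simp add: field_simps)
  ultimately have pg: "\<bar>poly p \<gamma>\<bar> \<le> \<gamma> ^ Suc n / (1 - \<gamma>)" "\<bar>poly p \<gamma>\<bar> \<le> \<epsilon> * \<delta>"
    by auto
  have "\<epsilon> * \<delta> < \<delta>"
    using g half delta_pos by simp
  have ex: "\<exists>x\<in>{0..0.6491}. poly p x = 0"
  proof (rule ccontr)
    assume no_root: "\<not> ?thesis"
    have pos: "poly p x > 0" if x: "x \<in> {0..0.6491}" for x
    proof (rule ccontr)
      assume "\<not> poly p x > 0"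
      moreover have "poly p 0 = 1" using p0 by (simp add: poly_0_coeff_0)
      moreover have "continuous_on {0..x} (poly p)"
        by (intro continuous_at_imp_continuous_on ballI poly_isCont)
      ultimately obtain t where "0 \<le> t" "t \<le> x" "poly p t = 0"
        using IVT2'[of "poly p" x 0 0] x by auto
      then show False using no_root x by auto
    qed
    \<comment> \<open>This contradicts p(\<gamma>) <= \<epsilon> \<delta>, because \<epsilon> <=
      0.6491 - \<gamma>.\<close>
    have "\<delta> * (0.6491 - \<gamma>) < poly p \<gamma>"
    proof (cases "\<gamma> \<le> 0.61")
      case True
      have "\<delta> < 0.461"
        using transv half g by (intro transversality_bound_half) auto
      then have "\<delta> * (0.6491 - \<gamma>) < 0.461 * (0.6491 - \<gamma>)"
        using g by (intro mult_strict_right_mono) auto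
      also have "\<dots> < poly p \<gamma>"
        using pos[of "0.6491"] half True by (intro unit_poly_drop_low[OF p0 pj]) auto
      finally show ?thesis .
    next
      case False
      then show ?thesis
        using g pos[of "0.6491"]
        by (intro unit_poly_drop_high[OF p0 pj] transversality_bound_61[OF transv]
              transversality_bound_645[OF transv]) auto
    qed
    moreover have "\<epsilon> * \<delta> \<le> \<delta> * (0.6491 - \<gamma>)"
      using g delta_pos by (simp add: mult.commute[of \<epsilon>])
    ultimately show False using pg(2) by linarith
  qed
  have "\<exists>!x. x \<in> {0..0.6491} \<and> poly p x = 0"
    using ex unit_poly_root_unique[OF p0 pj] by blast
  then have unique: "\<exists>!x. x \<in> {0..0.6491} \<and> (\<Sum>j\<le>n. b j * x ^ j) = 0"
    using b0 by (auto simp: P)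
  have "\<bar>x - \<gamma>\<bar> \<le> (1 / (\<delta> * (1 - \<gamma>))) * \<gamma> ^ n"
    if x: "x \<in> {\<gamma>_low..\<gamma>_high}" and le: "\<bar>\<Sum>j\<le>n. b j * x ^ j\<bar> \<le> \<gamma>_low ^ n" for x
  proof -
    have drop: "\<delta> * (v - u) \<le> poly p u - poly p v"
      if "0 \<le> u" "u \<le> v" "v \<le> \<gamma>_high" "poly p u < \<delta>" for u v
      using that transversality_poly[OF transv _ p0 pj] delta_pos
      by (intro drop_ge_if_deriv_less_below[where f' = "poly (pderiv p)"]) auto
    have "\<bar>poly p x\<bar> \<le> \<gamma>_low ^ n"
      using le b0 by (auto simp: P abs_mult)
    also have "\<dots> \<le> \<gamma> ^ n"
      using gamma_in low_pos by (intro power_mono) auto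
    finally have px: "\<bar>poly p x\<bar> \<le> \<gamma> ^ n" .
    \<comment> \<open>The hypothesis controls \<gamma>^(n+1) only; \<gamma> >= 1/2 recovers
      \<gamma>^n <= \<epsilon> \<delta> < \<delta>, which puts p(x) in the range where
      transversality acts.\<close>
    have "\<gamma> ^ n * (1/2) \<le> \<gamma> ^ n * \<gamma>"
      using half by (intro mult_left_mono) auto
    also have "\<dots> \<le> \<epsilon> * \<delta> * (1 - \<gamma>)"
      using pow by (simp add: mult.commute)
    also have "\<dots> \<le> \<epsilon> * \<delta> * (1/2)"
      using half eps_pos delta_pos by (intro mult_left_mono) auto
    finally have "\<gamma> ^ n < \<delta>"
      using \<open>\<epsilon> * \<delta> < \<delta>\<close> by simp
    then have below: "poly p x < \<delta>" "poly p \<gamma> < \<delta>"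
      using px pg(2) \<open>\<epsilon> * \<delta> < \<delta>\<close> by linarith+
    \<comment> \<open>Both values are below \<delta>, so the descent estimate can start from
      whichever of x and \<gamma> is smaller.\<close>
    have "\<delta> * \<bar>x - \<gamma>\<bar> \<le> \<bar>poly p x - poly p \<gamma>\<bar>"
    proof (cases "x \<le> \<gamma>")
      case True
      then show ?thesis using drop[of x \<gamma>] below x low_pos g by simp
    next
      case False
      then show ?thesis using drop[of \<gamma> x] below x g by simp
    qed
    also have "\<dots> \<le> \<gamma> ^ n + \<gamma> ^ Suc n / (1 - \<gamma>)"
      using pg(1) px by linarith
    also have "\<dots> = \<gamma> ^ n / (1 - \<gamma>)"
      using g by (simp add: field_simps)
    finally show ?thesis
      using delta_pos g by (simp add: field_simps)
  qed
  then show ?thesis using unique by blast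
qed

end
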